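(* Let $G$ be a finite permutation group on $\Omega$ with an abelian regular subgroup $A$ such that $A\neq G$ and $N_G(A)=A$. Then $|A|$ is not a prime power, and there exist subgroups $H,K$ of $A$ with $1<H\leq K<A$ such that the following holds: fix $\omega\in\Omega$ and identify $\Omega$ with $A$ via $a\leftrightarrow\omega^a$; then for every digraph $\Gamma$ on $\Omega$ with $G\leq\mathrm{Aut}(\Gamma)$, the corresponding Cayley digraph $\Gamma=\mathrm{Cay}(A,S)$ (for some $S\subseteq A$) is a generalized wreath digraph with respect to $(H,K,A)$.
   Context: All groups and digraphs are finite. A digraph is a pair $(V,R)$ with $V$ finite nonempty and $R\subseteq V\times V$ (loops allowed). For a group $G$ and $S\subseteq G$, $\mathrm{Cay}(G,S)$ has vertex set $G$, with $(g,h)$ an arc iff $gh^{-1}\in S$. If a regular abelian group $A$ acts as automorphisms of a digraph on $\Omega$, the identification $a\leftrightarrow\omega^a$ makes it a Cayley digraph $\mathrm{Cay}(A,S)$. Definition: for an abelian group $A$ and subgroups $1<H\leq K<A$, $\mathrm{Cay}(A,S)$ is a generalized wreath digraph with respect to $(H,K,A)$ if $S\setminus K$ is a union of $H$-cosets. *)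

theory Defs
  imports "HOL-Algebra.Algebra" "HOL-Computational_Algebra.Primes"
begin

text \<open>Permutations of the finite set Omega are modelled by the HOL-Algebra group
  BijGroup Omega (extensional bijections, product = composition). Elements act
  on points by function application.\<close>

definition sub_grp :: "'a set \<Rightarrow> ('a \<Rightarrow> 'a) set \<Rightarrow> ('a \<Rightarrow> 'a) monoid" where
  "sub_grp Om Y = BijGroup Om \<lparr>carrier := Y\<rparr>"

definition regular_on :: "'a set \<Rightarrow> ('a \<Rightarrow> 'a) set \<Rightarrow> bool" where
  "regular_on Om A \<longleftrightarrow> (\<forall>x\<in>Om. \<forall>y\<in>Om. \<exists>!a. a \<in> A \<and> a x = y)"

definition digraph_on :: "'a set \<Rightarrow> ('a \<times> 'a) set \<Rightarrow> bool" where
  "digraph_on Om R \<longleftrightarrow> R \<subseteq> Om \<times> Om"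

definition digraph_aut :: "'a set \<Rightarrow> ('a \<times> 'a) set \<Rightarrow> ('a \<Rightarrow> 'a) \<Rightarrow> bool" where
  "digraph_aut Om R g \<longleftrightarrow> g \<in> Bij Om \<and>
     (\<forall>x\<in>Om. \<forall>y\<in>Om. (x, y) \<in> R \<longleftrightarrow> (g x, g y) \<in> R)"

definition cayley_rep ::
  "'a set \<Rightarrow> ('a \<Rightarrow> 'a) set \<Rightarrow> 'a \<Rightarrow> ('a \<times> 'a) set \<Rightarrow> ('a \<Rightarrow> 'a) set \<Rightarrow> bool" where
  "cayley_rep Om A \<omega> R S \<longleftrightarrow> S \<subseteq> A \<and>
     (\<forall>g\<in>A. \<forall>h\<in>A. (g \<omega>, h \<omega>) \<in> R \<longleftrightarrow>
        g \<otimes>\<^bsub>sub_grp Om A\<^esub> inv\<^bsub>sub_grp Om A\<^esub> h \<in> S)"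

definition gen_wreath ::
  "'a set \<Rightarrow> ('a \<Rightarrow> 'a) set \<Rightarrow> ('a \<Rightarrow> 'a) set \<Rightarrow> ('a \<Rightarrow> 'a) set \<Rightarrow> ('a \<Rightarrow> 'a) set \<Rightarrow> bool" where
  "gen_wreath Om A H K S \<longleftrightarrow>
     (\<exists>C \<subseteq> rcosets\<^bsub>sub_grp Om A\<^esub> H. S - K = \<Union>C)"

end

theory Submission
  imports Defs
begin

text \<open>
  Shrinking \<open>G\<close>, one may assume that \<open>A\<close> is a maximal subgroup. Let \<open>L\<close> be a point stabilizer
  and \<open>Z\<close> the centre of \<open>G\<close>, so \<open>Z\<close> is a proper subgroup of \<open>A\<close>. Distinct conjugates of \<open>A\<close> meet in
  \<open>Z\<close>, and counting shows that \<open>N = L Z\<close> consists of \<open>Z\<close> and the elements in no conjugate of \<open>A\<close>;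
  so \<open>N\<close> is normal (this is the Frobenius kernel modulo \<open>Z\<close>, obtained without character theory),
  and it is abelian because \<open>L\<close> is core-free. For \<open>b \<in> A - Z\<close> the map \<open>n \<mapsto> b n b\<inverse> n\<inverse>\<close>
  is an endomorphism of \<open>N\<close> with kernel \<open>Z\<close>, and its image \<open>D\<close> meets \<open>Z\<close> trivially and does not
  depend on \<open>b\<close>. Take \<open>K = Z\<close> and let \<open>H\<close> be the projection of \<open>D\<close> to \<open>Z\<close> along \<open>L\<close>: every
  \<open>L\<close>-orbit outside \<open>K\<close> is then invariant under \<open>H\<close>, and \<open>H\<close> is trivial only if \<open>D \<subseteq> L\<close>, that is,
  only if \<open>L\<close> is trivial. If \<open>A\<close> were a \<open>p\<close>-group, \<open>p\<close> would divide \<open>card D\<close>, and \<open>A\<close> would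
  centralize a nontrivial element of \<open>D\<close>.
\<close>

section \<open>General group theory: centralizers, conjugation actions, fixed points of
  p-groups\<close>

lemma (in group) inv_mult_cancel:
  assumes "x \<in> carrier G" "y \<in> carrier G"
  shows "inv x \<otimes> (x \<otimes> y) = y" "x \<otimes> (inv x \<otimes> y) = y"
  using assms by (simp_all flip: m_assoc)

lemma (in group) subgroup_centralizer:
  assumes B: "B \<subseteq> carrier G"
  shows "subgroup {y \<in> carrier G. \<forall>x\<in>B. y \<otimes> x = x \<otimes> y} G" (is "subgroup ?C G")
proof (rule subgroupI)
  show "?C \<subseteq> carrier G" by blast
  show "?C \<noteq> {}" using B by (auto intro!: exI[of _ \<one>])
next
  fix y assume y: "y \<in> ?C"
  have "inv y \<otimes> x = x \<otimes> inv y" if x: "x \<in> B" for x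
  proof -
    have "inv y \<otimes> (y \<otimes> x) \<otimes> inv y = inv y \<otimes> (x \<otimes> y) \<otimes> inv y" using x y by simp
    moreover have "x \<in> carrier G" using x B by blast
    ultimately show ?thesis using y by (simp add: m_assoc inv_mult_cancel)
  qed
  then show "inv y \<in> ?C" using y by simp
next
  fix y z assume y: "y \<in> ?C" and z: "z \<in> ?C"
  have "y \<otimes> z \<otimes> x = x \<otimes> (y \<otimes> z)" if x: "x \<in> B" for x
  proof -
    have [simp]: "x \<in> carrier G" using x B by blast
    have "y \<otimes> z \<otimes> x = y \<otimes> (x \<otimes> z)" using x y z by (simp add: m_assoc)
    also have "\<dots> = (x \<otimes> y) \<otimes> z" using x y z by (simp flip: m_assoc)
    finally show ?thesis using y z by (simp add: m_assoc)
  qed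
  then show "y \<otimes> z \<in> ?C" using y z by simp
qed

lemma (in group) conjugation_action_on_subgroup:
  assumes A: "subgroup A G" and M: "subgroup M G"
    and norm: "\<And>a x. a \<in> A \<Longrightarrow> x \<in> M \<Longrightarrow> a \<otimes> x \<otimes> inv a \<in> M"
  shows "group_action (G\<lparr>carrier := A\<rparr>) M (\<lambda>a. \<lambda>x\<in>M. a \<otimes> x \<otimes> inv a)"
proof -
  let ?f = "\<lambda>a. \<lambda>x\<in>M. a \<otimes> x \<otimes> inv a"
  note mem [simp] = subgroup.mem_carrier[OF A] subgroup.mem_carrier[OF M]
  have bij: "?f a \<in> Bij M" if a: "a \<in> A" for a
  proof -
    have "inv a \<in> A" using a A by (simp add: subgroup.m_inv_closed)
    then have "bij_betw (\<lambda>x. a \<otimes> x \<otimes> inv a) M M"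
      using norm[of a] norm[of "inv a"] a
      by (intro bij_betw_byWitness[where f' = "\<lambda>x. inv a \<otimes> x \<otimes> inv (inv a)"])
         (auto simp: m_assoc inv_mult_cancel)
    then show ?thesis by (simp add: Bij_def cong: bij_betw_cong)
  qed
  have "?f \<in> hom (G\<lparr>carrier := A\<rparr>) (BijGroup M)"
  proof (rule homI)
    fix a b assume ab: "a \<in> carrier (G\<lparr>carrier := A\<rparr>)" "b \<in> carrier (G\<lparr>carrier := A\<rparr>)"
    then have "?f (a \<otimes> b) = compose M (?f a) (?f b)"
      using norm by (auto simp: compose_def m_assoc inv_mult_group intro!: restrict_ext)
    with ab show "?f (a \<otimes>\<^bsub>G\<lparr>carrier := A\<rparr>\<^esub> b) = ?f a \<otimes>\<^bsub>BijGroup M\<^esub> ?f b"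
      using bij by (simp add: BijGroup_def)
  qed (use bij in \<open>simp add: BijGroup_def\<close>)
  then show ?thesis
    by (simp add: group_action_def group_hom_def group_hom_axioms_def group_BijGroup
        subgroup.subgroup_is_group[OF A])
qed

text \<open>Orbit lengths divide a power of \<open>p\<close>. If \<open>x\<close> were the only
  fixed point, every orbit other than \<open>{x}\<close> would have length divisible by
  \<open>p\<close>, and \<open>card E\<close> would be 1 modulo \<open>p\<close>.\<close>

lemma (in group_action) p_group_fixed_points:
  assumes p: "Factorial_Ring.prime (p::nat)" and ord: "order G = p ^ k" and fin: "finite E"
    and dvd: "p dvd card E" and x: "x \<in> E" and fixed: "\<And>g. g \<in> carrier G \<Longrightarrow> \<phi> g x = x"
  shows "\<exists>y\<in>E. y \<noteq> x \<and> (\<forall>g\<in>carrier G. \<phi> g y = y)"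
proof (rule ccontr)
  assume "\<not> ?thesis"
  then have neg: "\<exists>g\<in>carrier G. \<phi> g y \<noteq> y" if "y \<in> E" "y \<noteq> x" for y
    using that by blast
  have grp: "group G" using group_hom by (simp add: group_hom_def)
  have one: "\<one> \<in> carrier G" by (simp add: grp group.is_monoid monoid.one_closed)
  have orbx: "orbit G \<phi> x = {x}"
    unfolding orbit_def using fixed one by (auto intro!: exI[of _ \<one>])
  have sub: "O' \<subseteq> E" if "O' \<in> orbits G E \<phi>" for O' using orbits_coverture that by auto
  have fo: "finite (orbits G E \<phi>)" using fin by (simp add: orbits_def)
  have "p dvd card O'" if O': "O' \<in> orbits G E \<phi> - {{x}}" for O'
  proof -
    obtain y where y: "y \<in> E" "O' = orbit G \<phi> y" using O' by (auto simp: orbits_def)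
    then have "y \<noteq> x" using O' orbx by auto
    then obtain g where g: "g \<in> carrier G" "\<phi> g y \<noteq> y" using neg y by blast
    have "y \<in> O'" using y orbit_refl by blast
    moreover have "\<phi> g y \<in> O'" using y g by (auto simp: orbit_def)
    ultimately have "O' \<noteq> {z}" for z using g by auto
    then have "card O' \<noteq> 1" by (metis card_1_singletonE)
    moreover have "card O' dvd p ^ k"
      using orbit_stabilizer_theorem[OF y(1)] y ord by (metis dvd_triv_left)
    ultimately show "p dvd card O'"
      using p by (metis divides_primepow_nat power_0 dvd_power not_gr_zero)
  qed
  then have "p dvd (\<Sum>O'\<in>orbits G E \<phi> - {{x}}. card O')" by (rule dvd_sum)
  moreover have "(\<Sum>O'\<in>orbits G E \<phi>. card O') = card E"
    using disjoint_sum[OF fin, of "\<lambda>_. 1::nat"] by simp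
  moreover have "{x} \<in> orbits G E \<phi>" using x orbx by (auto simp: orbits_def)
  then have "(\<Sum>O'\<in>orbits G E \<phi>. card O') = 1 + (\<Sum>O'\<in>orbits G E \<phi> - {{x}}. card O')"
    using fo by (simp add: sum.remove)
  ultimately have "p dvd 1" using dvd by (metis dvd_add_left_iff)
  then show False using p by simp
qed

section \<open>The abstract setting\<close>

text \<open>\<open>L\<close> stands for a point stabilizer: \<open>factor\<close> and
  \<open>meet\<close> express that \<open>A\<close> is regular, \<open>core_free\<close> that the
  action is faithful. By \<open>factor\<close>, conjugating with \<open>A\<close> alone reaches all
  conjugates of \<open>L\<close>. By finiteness, the inclusion in \<open>selfnorm\<close> amounts to
  normalizing \<open>A\<close>.\<close>

locale maximal_selfnormalizing = group +
  fixes A L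
  assumes finite_carrier: "finite (carrier G)"
    and A: "subgroup A G" and L: "subgroup L G"
    and A_comm: "\<And>a b. a \<in> A \<Longrightarrow> b \<in> A \<Longrightarrow> a \<otimes> b = b \<otimes> a"
    and factor: "\<And>x. x \<in> carrier G \<Longrightarrow> \<exists>l\<in>L. \<exists>a\<in>A. x = l \<otimes> a"
    and meet: "\<And>x. x \<in> A \<Longrightarrow> x \<in> L \<Longrightarrow> x = \<one>"
    and core_free: "\<And>x. x \<in> carrier G \<Longrightarrow> (\<And>a. a \<in> A \<Longrightarrow> inv a \<otimes> x \<otimes> a \<in> L) \<Longrightarrow> x = \<one>"
    and selfnorm: "\<And>x. x \<in> carrier G \<Longrightarrow> (\<And>a. a \<in> A \<Longrightarrow> x \<otimes> a \<otimes> inv x \<in> A) \<Longrightarrow> x \<in> A"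
    and proper: "A \<noteq> carrier G"
    and maximal: "\<And>B. subgroup B G \<Longrightarrow> A \<subseteq> B \<Longrightarrow> B = A \<or> B = carrier G"
begin

text \<open>This is the whole centre: a central element normalizes \<open>A\<close>, so
  \<open>selfnorm\<close> puts it in \<open>A\<close>.\<close>

definition Z where "Z = {z \<in> A. \<forall>x\<in>carrier G. z \<otimes> x = x \<otimes> z}"

definition N where "N = {x \<in> carrier G. \<exists>l\<in>L. \<exists>z\<in>Z. x = l \<otimes> z}"

definition comm where "comm b x = b \<otimes> x \<otimes> inv b \<otimes> inv x"

lemmas A_mem [simp] = subgroup.mem_carrier[OF A]
lemmas L_mem [simp] = subgroup.mem_carrier[OF L]
lemmas A_closed = subgroup.m_closed[OF A] subgroup.m_inv_closed[OF A] subgroup.one_closed[OF A]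
lemmas L_closed = subgroup.m_closed[OF L] subgroup.m_inv_closed[OF L] subgroup.one_closed[OF L]
lemmas word = m_assoc inv_mult_group inv_mult_cancel

lemma Z_A: "z \<in> Z \<Longrightarrow> z \<in> A" unfolding Z_def by blast

lemma Z_mem [simp]: "z \<in> Z \<Longrightarrow> z \<in> carrier G" using Z_A by simp

lemma Z_comm: "z \<in> Z \<Longrightarrow> x \<in> carrier G \<Longrightarrow> z \<otimes> x = x \<otimes> z" unfolding Z_def by blast

lemma subgroup_Z: "subgroup Z G"
proof -
  have "Z = A \<inter> {y \<in> carrier G. \<forall>x\<in>carrier G. y \<otimes> x = x \<otimes> y}"
    unfolding Z_def by auto
  then show ?thesis using subgroups_Inter_pair[OF A subgroup_centralizer[OF order.refl]] by metis
qed

lemmas Z_closed = subgroup.m_closed[OF subgroup_Z] subgroup.m_inv_closed[OF subgroup_Z]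
  subgroup.one_closed[OF subgroup_Z]

section \<open>Conjugates of \<open>A\<close> and their intersections\<close>

text \<open>An element of two distinct conjugates of \<open>A\<close> is centralized by both, hence by the
  group they generate, which is everything by maximality.\<close>

lemma malnormal_mod_Z:
  assumes x: "x \<in> A" "x \<notin> Z" and g: "g \<in> carrier G" and xg: "g \<otimes> x \<otimes> inv g \<in> A"
  shows "g \<in> A"
proof -
  define C where "C = {y \<in> carrier G. \<forall>x'\<in>{x}. y \<otimes> x' = x' \<otimes> y}"
  have "subgroup C G" using x unfolding C_def by (intro subgroup_centralizer) simp
  moreover have AC: "A \<subseteq> C" using x A_comm by (auto simp: C_def)
  ultimately consider "C = A" | "C = carrier G" using maximal by blast
  then show ?thesis
  proof cases
    case 1
    \<comment> \<open>\<open>a\<close> commutes with the conjugate of \<open>x\<close>, both being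
      in \<open>A\<close>; conjugate this relation back by \<open>g\<close>. Since
      \<open>C = A\<close>, it follows that \<open>inv g\<close> normalizes
      \<open>A\<close>.\<close>
    have "inv g \<otimes> a \<otimes> g \<in> C" if a: "a \<in> A" for a
    proof -
      have "a \<otimes> (g \<otimes> x \<otimes> inv g) = (g \<otimes> x \<otimes> inv g) \<otimes> a" using a xg A_comm by blast
      then have "inv g \<otimes> (a \<otimes> (g \<otimes> x \<otimes> inv g)) \<otimes> g = inv g \<otimes> ((g \<otimes> x \<otimes> inv g) \<otimes> a) \<otimes> g" by simp
      then show ?thesis using a g x by (simp add: C_def word)
    qed
    then have "inv g \<in> A" using 1 selfnorm[of "inv g"] g by simp
    then show ?thesis using g A_closed(2)[of "inv g"] by simp
  next
    case 2
    have "x \<otimes> y = y \<otimes> x" if "y \<in> carrier G" for y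
      using that 2 unfolding C_def by (metis (mono_tags, lifting) mem_Collect_eq singletonI)
    then have "x \<in> Z" using x unfolding Z_def by blast
    with x show ?thesis by simp
  qed
qed

lemma ex_noncentral: "\<exists>c. c \<in> A \<and> c \<notin> Z"
proof (rule ccontr)
  assume "\<not> ?thesis"
  then have "A = Z" using Z_A by blast
  have "x \<in> A" if x: "x \<in> carrier G" for x
  proof (rule selfnorm[OF x])
    fix a assume a: "a \<in> A"
    then have "x \<otimes> a = a \<otimes> x" using \<open>A = Z\<close> x Z_comm by metis
    with a x show "x \<otimes> a \<otimes> inv x \<in> A" by (simp add: m_assoc)
  qed
  then show False using proper by auto
qed

text \<open>Write \<open>y = l \<otimes> b\<close>. As \<open>b\<close> commutes with
  \<open>a\<close>, the conjugate is \<open>l \<otimes> a \<otimes> inv l\<close>, so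
  \<open>a\<close> lies in \<open>L\<close> as well. For permutations: a nontrivial element of a
  regular group fixes no point.\<close>

lemma conj_L:
  assumes "y \<in> carrier G" "a \<in> A" "y \<otimes> a \<otimes> inv y \<in> L"
  shows "a = \<one>"
proof -
  obtain l b where lb: "l \<in> L" "b \<in> A" "y = l \<otimes> b" using factor assms by blast
  have "b \<otimes> a \<otimes> inv b = a" using lb A_comm[of b a] assms by (simp add: word)
  moreover have "y \<otimes> a \<otimes> inv y = l \<otimes> (b \<otimes> a \<otimes> inv b) \<otimes> inv l"
    using lb assms(1,2) by (simp add: word)
  ultimately have "y \<otimes> a \<otimes> inv y = l \<otimes> a \<otimes> inv l" by simp
  then have "inv l \<otimes> (l \<otimes> a \<otimes> inv l) \<otimes> l \<in> L"
    using assms lb by (simp add: L_closed)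
  then have "a \<in> L" using lb assms by (simp add: word)
  then show ?thesis using meet assms by blast
qed

section \<open>The abelian normal subgroup \<open>N\<close>\<close>

lemma N_memI [intro]: "l \<in> L \<Longrightarrow> z \<in> Z \<Longrightarrow> l \<otimes> z \<in> N"
  unfolding N_def by auto

lemma N_mem [simp]: "x \<in> N \<Longrightarrow> x \<in> carrier G" unfolding N_def by blast

lemma N_memE: "x \<in> N \<Longrightarrow> \<exists>l\<in>L. \<exists>z\<in>Z. x = l \<otimes> z" unfolding N_def by blast

text \<open>Counting: the products \<open>l \<otimes> z\<close> and the conjugates \<open>l \<otimes> a \<otimes> inv l\<close> with \<open>a \<in> A - Z\<close>
  are \<open>card L * card A\<close> different elements, so they exhaust the group.\<close>

lemma noncentral_conjugate:
  assumes "x \<in> carrier G" "x \<notin> N"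
  shows "\<exists>l\<in>L. \<exists>a\<in>A - Z. x = l \<otimes> a \<otimes> inv l"
proof -
  let ?f = "\<lambda>(l, z). l \<otimes> z" and ?g = "\<lambda>(l, a). l \<otimes> a \<otimes> inv l"
  have fin: "finite A" "finite L" "finite Z"
    using finite_carrier by (auto intro: finite_subset[of _ "carrier G"])
  \<comment> \<open>This serves twice: it gives the order of the group and, by restriction, the size
    of \<open>N\<close>.\<close>
  have inj: "inj_on ?f (L \<times> A)"
  proof (rule inj_onI, clarify)
    fix l a l' a' assume h: "l \<in> L" "a \<in> A" "l' \<in> L" "a' \<in> A" "l \<otimes> a = l' \<otimes> a'"
    then have "inv l' \<otimes> (l \<otimes> a) \<otimes> inv a = inv l' \<otimes> (l' \<otimes> a') \<otimes> inv a" by simp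
    then have e: "inv l' \<otimes> l = a' \<otimes> inv a" using h(1-4) by (simp add: word)
    have "inv l' \<otimes> l \<in> L" "a' \<otimes> inv a \<in> A" using h(1-4) by (simp_all add: A_closed L_closed)
    then have "inv l' \<otimes> l = \<one>" using e meet by metis
    then show "l = l' \<and> a = a'" using h(1-4) e by (simp add: inv_solve_right' inv_solve_left')
  qed
  have "?f ` (L \<times> A) = carrier G" using factor by force
  then have cG: "card (carrier G) = card L * card A"
    using card_image[OF inj] by (simp add: card_cartesian_product)
  have N_eq: "N = ?f ` (L \<times> Z)" unfolding N_def by force
  have "L \<times> Z \<subseteq> L \<times> A" using Z_A by blast
  then have cN: "card N = card L * card Z"
    using card_image[OF inj_on_subset[OF inj]] by (simp add: N_eq card_cartesian_product)
  \<comment> \<open>\<open>inv l' \<otimes> l\<close> conjugates the noncentral \<open>a\<close>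
    into \<open>A\<close>, so it lies in both \<open>A\<close> and \<open>L\<close>.\<close>
  have "inj_on ?g (L \<times> (A - Z))"
  proof (rule inj_onI, clarify)
    fix l a l' a' assume h: "l \<in> L" "a \<in> A" "a \<notin> Z" "l' \<in> L" "a' \<in> A"
      "l \<otimes> a \<otimes> inv l = l' \<otimes> a' \<otimes> inv l'"
    then have "inv l' \<otimes> (l \<otimes> a \<otimes> inv l) \<otimes> l' = inv l' \<otimes> (l' \<otimes> a' \<otimes> inv l') \<otimes> l'" by simp
    then have e: "(inv l' \<otimes> l) \<otimes> a \<otimes> inv (inv l' \<otimes> l) = a'" using h(1-5) by (simp add: word)
    then have "inv l' \<otimes> l \<in> A" using h malnormal_mod_Z[of a "inv l' \<otimes> l"] by simp
    then have o: "inv l' \<otimes> l = \<one>" using h meet by (simp add: L_closed)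
    then have "a = a'" using e h by simp
    then show "l = l' \<and> a = a'" using h o by (simp add: inv_solve_left')
  qed
  then have cg: "card (?g ` (L \<times> (A - Z))) = card L * (card A - card Z)"
    using fin card_Diff_subset[of Z A] Z_A
    by (auto simp: card_image card_cartesian_product)
  \<comment> \<open>Moving the central \<open>z\<close> to the other side makes \<open>l\<close> a
    conjugate of \<open>a \<otimes> inv z\<close>, and \<open>conj_L\<close> forces
    \<open>a = z\<close>.\<close>
  have disj: "N \<inter> ?g ` (L \<times> (A - Z)) = {}"
  proof (rule ccontr)
    assume "\<not> ?thesis"
    then obtain l z k a where h: "l \<in> L" "z \<in> Z" "k \<in> L" "a \<in> A" "a \<notin> Z"
      "l \<otimes> z = k \<otimes> a \<otimes> inv k" by (auto simp: N_eq)
    have "l = k \<otimes> a \<otimes> inv k \<otimes> inv z" using h(1-4) h(6)[symmetric] by (simp add: inv_solve_right)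
    also have "\<dots> = k \<otimes> (a \<otimes> inv z) \<otimes> inv k"
      using h(1-4) Z_comm[of "inv z" "inv k"] by (simp add: word Z_closed)
    finally have "a \<otimes> inv z = \<one>" using h conj_L[of k "a \<otimes> inv z"] by (simp add: A_closed Z_A)
    then have "a = z" using h(1-4) by (simp add: inv_solve_right')
    then show False using h by simp
  qed
  have "card (N \<union> ?g ` (L \<times> (A - Z))) = card L * card Z + card L * (card A - card Z)"
    using disj fin cN cg by (subst card_Un_disjoint) (auto simp: N_eq)
  also have "\<dots> = card (carrier G)"
  proof -
    have "card Z \<le> card A" using fin Z_A by (intro card_mono) auto
    then show ?thesis using cG by (simp flip: distrib_left)
  qed
  finally have "N \<union> ?g ` (L \<times> (A - Z)) = carrier G"
    using finite_carrier by (intro card_subset_eq) auto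
  then have "x \<in> ?g ` (L \<times> (A - Z))" using assms by blast
  then show ?thesis by force
qed

text \<open>Outside \<open>N\<close> there are only conjugates of elements of \<open>A - Z\<close>.
  If a conjugate of \<open>x\<close> left \<open>N\<close>, then \<open>x\<close> itself would be
  conjugate to some \<open>a\<close> in \<open>A - Z\<close>; stripping off the central factor of
  \<open>x\<close> contradicts \<open>conj_L\<close>.\<close>

lemma N_normal:
  assumes g: "g \<in> carrier G" and x: "x \<in> N"
  shows "g \<otimes> x \<otimes> inv g \<in> N"
proof (rule ccontr)
  assume "\<not> ?thesis"
  then obtain k a where ka: "k \<in> L" "a \<in> A" "a \<notin> Z" "g \<otimes> x \<otimes> inv g = k \<otimes> a \<otimes> inv k"
    using noncentral_conjugate[of "g \<otimes> x \<otimes> inv g"] g x by auto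
  obtain l z where lz: "l \<in> L" "z \<in> Z" "x = l \<otimes> z" using N_memE[OF x] by blast
  let ?y = "inv g \<otimes> k"
  have "inv g \<otimes> (g \<otimes> x \<otimes> inv g) \<otimes> g = inv g \<otimes> (k \<otimes> a \<otimes> inv k) \<otimes> g" using ka by simp
  then have "l \<otimes> z = ?y \<otimes> a \<otimes> inv ?y" using g ka(1-3) lz by (simp add: word)
  moreover have "l = l \<otimes> z \<otimes> inv z" using lz(1,2) by (simp add: word)
  ultimately have "l = ?y \<otimes> a \<otimes> inv ?y \<otimes> inv z" by simp
  also have "\<dots> = ?y \<otimes> (a \<otimes> inv z) \<otimes> inv ?y"
    using g ka(1-3) lz(1,2) Z_comm[of "inv z" "inv ?y"] by (simp add: word Z_closed)
  finally have "a \<otimes> inv z = \<one>" using g ka(1-3) lz(1,2) conj_L[of ?y "a \<otimes> inv z"] by (simp add: A_closed Z_A)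
  then have "a = z" using ka(1,2) lz(1,2) by (simp add: inv_solve_right')
  then show False using ka lz by simp
qed

lemma subgroup_N: "subgroup N G"
proof (rule subgroupI)
  show "N \<subseteq> carrier G" by auto
  show "N \<noteq> {}" using N_memI[of \<one> \<one>] by (auto simp: L_closed Z_closed)
next
  fix x assume "x \<in> N"
  then obtain l z where lz: "l \<in> L" "z \<in> Z" "x = l \<otimes> z" using N_memE by blast
  then have "inv x = inv l \<otimes> inv z" using Z_comm[of "inv z" "inv l"] by (simp add: word Z_closed)
  then show "inv x \<in> N" using lz by (auto simp: L_closed Z_closed)
next
  fix x y assume "x \<in> N" "y \<in> N"
  then obtain l z l' z' where lz: "l \<in> L" "z \<in> Z" "x = l \<otimes> z" "l' \<in> L" "z' \<in> Z" "y = l' \<otimes> z'"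
    using N_memE by meson
  then have "z \<otimes> (l' \<otimes> z') = l' \<otimes> (z \<otimes> z')" using Z_comm[of z "l'"] by (simp flip: m_assoc)
  then have "x \<otimes> y = (l \<otimes> l') \<otimes> (z \<otimes> z')" using lz by (simp add: word)
  then show "x \<otimes> y \<in> N" using lz by (auto simp: L_closed Z_closed)
qed

lemmas N_closed = subgroup.m_closed[OF subgroup_N] subgroup.m_inv_closed[OF subgroup_N]
  subgroup.one_closed[OF subgroup_N]

lemma N_A: "x \<in> N \<Longrightarrow> x \<in> A \<Longrightarrow> x \<in> Z"
proof -
  assume "x \<in> N" "x \<in> A"
  then obtain l z where lz: "l \<in> L" "z \<in> Z" "x = l \<otimes> z" using N_memE by blast
  then have "l = x \<otimes> inv z" by (simp add: word)
  moreover have "x \<otimes> inv z \<in> A" using lz \<open>x \<in> A\<close> by (simp add: A_closed Z_A)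
  ultimately have "l = \<one>" using lz(1) meet by metis
  then show "x \<in> Z" using lz by simp
qed

text \<open>Every conjugate of \<open>N\<close> lies in \<open>L\<close> times the centre, so every conjugate of a commutator of
  \<open>N\<close> is in \<open>L\<close>.\<close>

lemma N_comm:
  assumes xy: "x \<in> N" "y \<in> N"
  shows "x \<otimes> y = y \<otimes> x"
proof -
  have "x \<otimes> y \<otimes> inv x \<otimes> inv y = \<one>"
  proof (rule core_free)
    fix a assume a: "a \<in> A"
    let ?x = "inv a \<otimes> x \<otimes> a" and ?y = "inv a \<otimes> y \<otimes> a"
    have "?x \<in> N" "?y \<in> N" using a xy N_normal[of "inv a"] by auto
    then obtain l z l' z' where lz: "l \<in> L" "z \<in> Z" "?x = l \<otimes> z" "l' \<in> L" "z' \<in> Z" "?y = l' \<otimes> z'"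
      using N_memE by meson
    have "inv a \<otimes> (x \<otimes> y \<otimes> inv x \<otimes> inv y) \<otimes> a = ?x \<otimes> ?y \<otimes> inv ?x \<otimes> inv ?y"
      using a xy by (simp add: word)
    \<comment> \<open>The central \<open>z\<close> and \<open>z'\<close> cancel against their
      inverses.\<close>
    also have "\<dots> = l \<otimes> l' \<otimes> inv l \<otimes> inv l'"
    proof -
      have "?x \<otimes> ?y \<otimes> inv ?x \<otimes> inv ?y
          = l \<otimes> (z \<otimes> (l' \<otimes> (z' \<otimes> (inv z \<otimes> (inv l \<otimes> (inv z' \<otimes> inv l'))))))"
        unfolding lz(3,6) using lz by (simp add: word)
      also have "z' \<otimes> (inv z \<otimes> (inv l \<otimes> (inv z' \<otimes> inv l')))
          = z' \<otimes> (inv z \<otimes> inv l) \<otimes> (inv z' \<otimes> inv l')"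
        using lz(1,2,4,5) by (simp add: word)
      also have "z' \<otimes> (inv z \<otimes> inv l) = inv z \<otimes> inv l \<otimes> z'"
        using lz(1,2,4,5) by (intro Z_comm) simp_all
      also have "inv z \<otimes> inv l \<otimes> z' \<otimes> (inv z' \<otimes> inv l') = inv z \<otimes> (inv l \<otimes> inv l')"
        using lz(1,2,4,5) by (simp add: word)
      also have "z \<otimes> (l' \<otimes> (inv z \<otimes> (inv l \<otimes> inv l'))) = l' \<otimes> (inv l \<otimes> inv l')"
        using lz Z_comm[of z "l'"] by (simp add: inv_mult_cancel flip: m_assoc[of z l'])
                                      (simp add: word)
      finally show ?thesis using lz by (simp add: word)
    qed
    finally show "inv a \<otimes> (x \<otimes> y \<otimes> inv x \<otimes> inv y) \<otimes> a \<in> L"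
      using lz by (simp add: L_closed)
  qed (use xy in simp)
  then show ?thesis using xy
    by (simp add: inv_solve_right')
qed

lemma N_left_commute:
  "x \<in> N \<Longrightarrow> y \<in> N \<Longrightarrow> z \<in> carrier G \<Longrightarrow> x \<otimes> (y \<otimes> z) = y \<otimes> (x \<otimes> z)"
  using N_comm[of x y] by (simp flip: m_assoc)

section \<open>Commutator maps on \<open>N\<close> and their images\<close>

lemma comm_N: "b \<in> carrier G \<Longrightarrow> x \<in> N \<Longrightarrow> comm b x \<in> N"
  using N_normal[of b x] by (simp add: comm_def N_closed)

text \<open>\<open>comm b y\<close> and \<open>inv x\<close> both lie in the abelian group
  \<open>N\<close> and can be interchanged.\<close>

lemma comm_mult:
  assumes b: "b \<in> carrier G" and xy: "x \<in> N" "y \<in> N"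
  shows "comm b (x \<otimes> y) = comm b x \<otimes> comm b y"
proof -
  have "comm b (x \<otimes> y) = b \<otimes> x \<otimes> inv b \<otimes> (comm b y \<otimes> inv x)"
    using b xy by (simp add: comm_def word)
  also have "comm b y \<otimes> inv x = inv x \<otimes> comm b y"
    using b xy by (intro N_comm comm_N) (simp_all add: N_closed)
  also have "b \<otimes> x \<otimes> inv b \<otimes> (inv x \<otimes> comm b y) = comm b x \<otimes> comm b y"
    using b xy by (simp add: comm_def word)
  finally show ?thesis .
qed

lemma comm_Z: "b \<in> carrier G \<Longrightarrow> z \<in> Z \<Longrightarrow> comm b z = \<one>"
  using Z_comm[of z b] by (simp add: comm_def inv_solve_right')

text \<open>The conjugate of \<open>inv b\<close> by \<open>x\<close> is
  \<open>inv b \<otimes> comm b x\<close>, which is in \<open>A\<close> when the commutator is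
  central. Malnormality then puts \<open>x\<close> in \<open>A\<close>, and \<open>N\<close> meets
  \<open>A\<close> only in \<open>Z\<close>. This yields both the kernel of \<open>comm b\<close>
  and the trivial intersection in \<open>D_Z\<close>.\<close>

lemma comm_in_Z:
  assumes b: "b \<in> A" "b \<notin> Z" and x: "x \<in> N" and z: "comm b x \<in> Z"
  shows "x \<in> Z"
proof -
  have "x \<otimes> inv b \<otimes> inv x = inv b \<otimes> comm b x"
    using b x by (simp add: comm_def word)
  moreover have "inv b \<otimes> comm b x \<in> A" using b z by (simp add: A_closed Z_A)
  moreover have "inv b \<in> A" "inv b \<notin> Z"
    using b A_closed(2) Z_closed(2)[of "inv b"] by auto
  ultimately have "x \<in> A" using malnormal_mod_Z[of "inv b" x] x by simp
  then show ?thesis using N_A x by blast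
qed

text \<open>In the expanded double commutator the factors from \<open>N\<close> commute, and so do
  \<open>b\<close> and \<open>c\<close>; the result is symmetric in \<open>b\<close> and
  \<open>c\<close>.\<close>

lemma comm_comm:
  assumes bc: "b \<in> A" "c \<in> A" and x: "x \<in> N"
  shows "comm b (comm c x) = comm c (comm b x)"
proof -
  let ?n = "\<lambda>b. b \<otimes> inv x \<otimes> inv b"
  have n: "?n b \<in> N" if "b \<in> A" for b using that x N_normal by (simp add: N_closed)
  have e: "comm b (comm c x) = (b \<otimes> c) \<otimes> x \<otimes> inv (b \<otimes> c) \<otimes> (?n b \<otimes> (x \<otimes> ?n c))"
    if "b \<in> A" "c \<in> A" for b c
    using that x by (simp add: comm_def word)
  have "?n b \<otimes> (x \<otimes> ?n c) = ?n c \<otimes> (x \<otimes> ?n b)"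
    using N_left_commute[of "?n b" x "?n c"] N_comm[of "?n b" "?n c"] N_left_commute[of "?n c" x "?n b"]
      n[OF bc(1)] n[OF bc(2)] x by simp
  then show ?thesis using e[of b c] e[of c b] bc A_comm[of b c] by simp
qed

definition D where "D c = comm c ` N"

lemma D_N: "c \<in> carrier G \<Longrightarrow> x \<in> D c \<Longrightarrow> x \<in> N"
  by (auto simp: D_def comm_N)

lemma subgroup_D:
  assumes c: "c \<in> carrier G"
  shows "subgroup (D c) G"
proof (rule subgroupI)
  show "D c \<subseteq> carrier G" using D_N[OF c] N_mem by blast
  show "D c \<noteq> {}" using N_closed(3) by (auto simp: D_def)
next
  fix u assume "u \<in> D c"
  then obtain x where x: "x \<in> N" "u = comm c x" unfolding D_def by blast
  have "comm c (inv x) \<otimes> u = comm c \<one>"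
    using x c comm_mult[of c "inv x" x] by (simp add: N_closed)
  also have "\<dots> = \<one>" using c by (simp add: comm_Z Z_closed)
  finally have "inv u = comm c (inv x)"
    using x c comm_N by (intro inv_equality) (simp_all add: N_closed)
  then show "inv u \<in> D c" using x by (simp add: D_def N_closed)
next
  fix u v assume "u \<in> D c" "v \<in> D c"
  then obtain x y where xy: "x \<in> N" "u = comm c x" "y \<in> N" "v = comm c y"
    unfolding D_def by blast
  then have "u \<otimes> v = comm c (x \<otimes> y)" using c comm_mult by simp
  then show "u \<otimes> v \<in> D c" using xy by (simp add: D_def N_closed)
qed

lemma D_Z:
  assumes "c \<in> A" "c \<notin> Z" "x \<in> D c" "x \<in> Z"
  shows "x = \<one>"
proof -
  obtain y where y: "y \<in> N" "x = comm c y" using assms unfolding D_def by blast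
  then have "y \<in> Z" using assms comm_in_Z by blast
  then show ?thesis using y comm_Z assms by simp
qed

text \<open>Since \<open>comm b\<close> and \<open>comm c\<close> commute, \<open>comm b\<close> maps \<open>D c\<close> into itself; being injective
  there, it is onto.\<close>

lemma D_subset:
  assumes b: "b \<in> A" "b \<notin> Z" and c: "c \<in> A" "c \<notin> Z"
  shows "D c \<subseteq> D b"
proof -
  interpret D: subgroup "D c" G using subgroup_D c by simp
  \<comment> \<open>The kernel of \<open>comm b\<close> on \<open>N\<close> is \<open>Z\<close>,
    which meets \<open>D c\<close> trivially.\<close>
  have "inj_on (comm b) (D c)"
  proof (rule inj_onI)
    fix x y assume xy: "x \<in> D c" "y \<in> D c" and e: "comm b x = comm b y"
    have N: "x \<in> N" "y \<in> N" using D_N[OF A_mem[OF c(1)]] xy by blast+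
    have "x = (x \<otimes> inv y) \<otimes> y" using N by (simp add: word)
    then have "comm b y = comm b (x \<otimes> inv y) \<otimes> comm b y"
      using e N b comm_mult[of b "x \<otimes> inv y" y] by (simp add: N_closed)
    moreover have cl: "comm b y \<in> carrier G" "comm b (x \<otimes> inv y) \<in> carrier G"
      using N b comm_N by (simp_all add: N_closed)
    ultimately have "comm b (x \<otimes> inv y) = \<one>" by simp
    then have "x \<otimes> inv y \<in> Z"
      using b N comm_in_Z[of b "x \<otimes> inv y"] by (simp add: N_closed Z_closed)
    then have "x \<otimes> inv y = \<one>" using D_Z[OF c] xy by simp
    then show "x = y" using N by (simp add: inv_solve_right')
  qed
  moreover have "comm b ` D c \<subseteq> D c"
  proof
    fix u assume "u \<in> comm b ` D c"
    then obtain x where "x \<in> N" "u = comm b (comm c x)" unfolding D_def by blast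
    then show "u \<in> D c" using comm_comm[of b c x] b c comm_N[of b x] unfolding D_def by simp
  qed
  moreover have "finite (D c)"
    using finite_carrier D.subset finite_subset by blast
  ultimately have "comm b ` D c = D c" using endo_inj_surj by metis
  moreover have "D c \<subseteq> N" using D_N[OF A_mem[OF c(1)]] by blast
  then have "comm b ` D c \<subseteq> D b" unfolding D_def[of b] by (rule image_mono)
  ultimately show ?thesis by simp
qed

text \<open>Since \<open>a\<close> commutes with \<open>c\<close>, conjugation by \<open>a\<close>
  commutes with \<open>comm c\<close>, and \<open>N\<close> is normal.\<close>

lemma D_conj:
  assumes c: "c \<in> A" "c \<notin> Z" and a: "a \<in> A" and x: "x \<in> D c"
  shows "a \<otimes> x \<otimes> inv a \<in> D c"
proof -
  obtain y where y: "y \<in> N" "x = comm c y" using x unfolding D_def by blast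
  have ca: "c \<otimes> a = a \<otimes> c" using c a A_comm by simp
  have "comm c (a \<otimes> y \<otimes> inv a) = (c \<otimes> a) \<otimes> y \<otimes> inv (c \<otimes> a) \<otimes> (a \<otimes> inv y \<otimes> inv a)"
    using a c y by (simp add: comm_def word)
  also have "\<dots> = a \<otimes> x \<otimes> inv a" unfolding ca y(2) using a c y by (simp add: comm_def word)
  finally show ?thesis using N_normal[of a y] a y unfolding D_def by (metis A_mem image_eqI)
qed

section \<open>The subgroup \<open>H\<close> and double cosets of \<open>L\<close>\<close>

definition H where "H c = {z \<in> Z. \<exists>l\<in>L. z \<otimes> l \<in> D c}"

lemma subgroup_H:
  assumes c: "c \<in> carrier G"
  shows "subgroup (H c) G"
proof (rule subgroupI)
  interpret D: subgroup "D c" G by (rule subgroup_D[OF c])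
  show "H c \<subseteq> carrier G" unfolding H_def by auto
  have "\<one> \<otimes> \<one> \<in> D c" by simp
  then have "\<one> \<in> H c" using L_closed(3) Z_closed(3) unfolding H_def by blast
  then show "H c \<noteq> {}" by blast
  fix z assume "z \<in> H c"
  then obtain l where zl: "z \<in> Z" "l \<in> L" "z \<otimes> l \<in> D c" unfolding H_def by blast
  have "inv z \<otimes> inv l = inv (z \<otimes> l)" using zl Z_comm[of "inv z" "inv l"]
    by (simp add: Z_closed inv_mult_group)
  then have "inv z \<otimes> inv l \<in> D c" using zl by simp
  then show "inv z \<in> H c" unfolding H_def using zl L_closed(2) Z_closed(2) by blast
  fix z' assume "z' \<in> H c"
  then obtain l' where zl': "z' \<in> Z" "l' \<in> L" "z' \<otimes> l' \<in> D c" unfolding H_def by blast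
  have "z \<otimes> z' \<otimes> (l \<otimes> l') = (z \<otimes> l) \<otimes> (z' \<otimes> l')"
    using zl zl' Z_comm[of z' "l \<otimes> l'"] Z_comm[of z' "l'"] by (simp add: m_assoc)
  then have "z \<otimes> z' \<otimes> (l \<otimes> l') \<in> D c" using zl zl' by simp
  then show "z \<otimes> z' \<in> H c" unfolding H_def using zl zl' L_closed(1) Z_closed(1) by blast
qed

text \<open>If \<open>H c\<close> is trivial, then \<open>D c\<close> lies in \<open>L\<close>;
  being invariant under \<open>A\<close>, it is trivial by \<open>core_free\<close>. So
  \<open>comm c\<close> kills \<open>L\<close>, which puts \<open>L\<close> inside \<open>Z\<close>;
  then \<open>L\<close> is trivial and \<open>A\<close> is the whole group.\<close>

lemma H_nontrivial:
  assumes c: "c \<in> A" "c \<notin> Z"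
  shows "H c \<noteq> {\<one>}"
proof
  assume H: "H c = {\<one>}"
  have DL: "x \<in> L" if x: "x \<in> D c" for x
  proof -
    obtain l z where lz: "l \<in> L" "z \<in> Z" "x = l \<otimes> z" using N_memE D_N x c by (meson A_mem)
    then have "z \<otimes> l \<in> D c" using x Z_comm[of z l] by simp
    then have "z \<in> H c" using lz unfolding H_def by blast
    then show ?thesis using H lz by simp
  qed
  have D1: "x = \<one>" if x: "x \<in> D c" for x
  proof (rule core_free)
    show "x \<in> carrier G" using D_N[OF _ x] c by simp
    fix a assume "a \<in> A"
    then have "inv a \<otimes> x \<otimes> inv (inv a) \<in> D c" using c x by (intro D_conj A_closed)
    then show "inv a \<otimes> x \<otimes> a \<in> L" using DL \<open>a \<in> A\<close> by simp
  qed
  have "l = \<one>" if l: "l \<in> L" for l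
  proof -
    have lN: "l \<in> N" using N_memI[OF l, of \<one>] l by (simp add: Z_closed)
    then have "comm c l = \<one>" using D1 unfolding D_def by blast
    then have "l \<in> Z" using comm_in_Z[of c l] c lN by (simp add: Z_closed)
    then show ?thesis using l meet Z_A by blast
  qed
  then have "x \<in> A" if "x \<in> carrier G" for x
    using factor[OF that] by (metis A_mem l_one)
  then show False using proper by auto
qed

text \<open>By \<open>D_subset\<close>, \<open>h \<otimes> k\<close> is also a value of
  \<open>comm (inv a)\<close>, and its argument may be taken in \<open>L\<close> because central
  factors contribute nothing. Solving \<open>h \<otimes> k = inv a \<otimes> l \<otimes> a \<otimes>
  inv l\<close> for \<open>a \<otimes> h\<close> gives the claim.\<close>

lemma H_double_coset:
  assumes c: "c \<in> A" "c \<notin> Z" and a: "a \<in> A" "a \<notin> Z" and h: "h \<in> H c"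
  shows "\<exists>l\<in>L. \<exists>l'\<in>L. l \<otimes> a \<otimes> l' = a \<otimes> h"
proof -
  obtain k where k: "h \<in> Z" "k \<in> L" "h \<otimes> k \<in> D c" using h unfolding H_def by blast
  have a': "inv a \<in> A" "inv a \<notin> Z"
    using a A_closed(2) Z_closed(2)[of "inv a"] by auto
  obtain x where x: "x \<in> N" "h \<otimes> k = comm (inv a) x"
    using D_subset[OF a' c] k unfolding D_def by blast
  obtain l z where lz: "l \<in> L" "z \<in> Z" "x = l \<otimes> z" using N_memE x by blast
  have N: "l \<in> N" "z \<in> N" using lz N_memI[of l \<one>] N_memI[of \<one> z] by (auto simp: Z_closed L_closed)
  have "h \<otimes> k = comm (inv a) l \<otimes> comm (inv a) z" using x lz N a by (simp add: comm_mult)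
  also have "\<dots> = inv a \<otimes> l \<otimes> a \<otimes> inv l"
    using lz a comm_Z[of "inv a" z] by (simp add: comm_def)
  finally have "a \<otimes> (h \<otimes> k) \<otimes> inv k = a \<otimes> (inv a \<otimes> l \<otimes> a \<otimes> inv l) \<otimes> inv k" by simp
  then have "a \<otimes> h = l \<otimes> a \<otimes> (inv l \<otimes> inv k)" using a k lz by (simp add: word)
  then show ?thesis using lz k by (metis L_closed(1,2))
qed

section \<open>The order of \<open>A\<close>\<close>

text \<open>Once \<open>p\<close> divides \<open>card (D c)\<close>, the \<open>p\<close>-group
  \<open>A\<close>, acting by conjugation on \<open>D c\<close> and fixing \<open>\<one>\<close>,
  fixes another element. That element is killed by \<open>comm c\<close>, so it lies in
  \<open>Z\<close>, against \<open>D_Z\<close>.\<close>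

lemma card_not_prime_power:
  assumes p: "Factorial_Ring.prime (p::nat)" and card: "card A = p ^ k"
  shows False
proof -
  obtain c where c: "c \<in> A" "c \<notin> Z" using ex_noncentral by blast
  have D: "subgroup (D c) G" using subgroup_D c by simp
  interpret D: subgroup "D c" G by (rule D)
  have finD: "finite (D c)" using finite_carrier D.subset finite_subset by blast
  interpret act: group_action "G\<lparr>carrier := A\<rparr>" "D c" "\<lambda>a. \<lambda>x\<in>D c. a \<otimes> x \<otimes> inv a"
    using D_conj[OF c] by (intro conjugation_action_on_subgroup A D)
  have "p dvd card (D c)"
  proof (rule ccontr)
    assume "\<not> p dvd card (D c)"
    then have cop: "coprime (card (D c)) (p ^ k)"
      using p by (metis coprime_commute coprime_power_left_iff prime_imp_coprime)
    \<comment> \<open>Raising \<open>h \<otimes> l\<close> to the power \<open>card (D c)\<close>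
      puts that power of \<open>h\<close> in \<open>L\<close>, so it is trivial. The order of
      \<open>h\<close> thus divides two coprime numbers.\<close>
    have "h = \<one>" if h: "h \<in> H c" for h
    proof -
      obtain l where l: "h \<in> Z" "l \<in> L" "h \<otimes> l \<in> D c" using h unfolding H_def by blast
      have "h [^] card (D c) \<otimes> l [^] card (D c) = (h \<otimes> l) [^] card (D c)"
        using l Z_comm[of h l] by (intro pow_mult_distrib[symmetric]) simp_all
      also have "\<dots> = \<one>"
        using group.pow_order_eq_1[OF subgroup.subgroup_is_group[OF D is_group], of "h \<otimes> l"] l
        by (simp add: order_def nat_pow_consistent[symmetric])
      finally have e: "h [^] card (D c) \<otimes> l [^] card (D c) = \<one>" .
      then have "h [^] card (D c) = inv (l [^] card (D c))"
        using l by (metis L_mem Z_mem inv_equality nat_pow_closed)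
      moreover have "h [^] n \<in> A" "l [^] n \<in> L" for n :: nat
        using l by (induction n) (simp_all add: A_closed L_closed Z_A)
      ultimately have "h [^] card (D c) = \<one>" using meet L_closed(2) by metis
      moreover have "h [^] (p ^ k) = \<one>"
        using group.pow_order_eq_1[OF subgroup.subgroup_is_group[OF A is_group], of h] l Z_A card
        by (simp add: order_def nat_pow_consistent[symmetric])
      ultimately have "ord h dvd card (D c)" "ord h dvd p ^ k"
        using l pow_eq_id by auto
      then have "ord h = 1" using cop coprime_common_divisor_nat by metis
      then show ?thesis using l ord_eq_1 by simp
    qed
    moreover have "\<one> \<in> H c" using subgroup_H[of c] c subgroup.one_closed[of "H c" G] by simp
    ultimately show False using H_nontrivial[OF c] by blast
  qed
  then obtain y where y: "y \<in> D c" "y \<noteq> \<one>" and fixed: "\<And>a. a \<in> A \<Longrightarrow> a \<otimes> y \<otimes> inv a = y"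
    using act.p_group_fixed_points[OF p, of k \<one>] finD card by (auto simp: order_def)
  have yN: "y \<in> N" using D_N[OF _ y(1)] c by simp
  have "comm c y = \<one>" using fixed[OF c(1)] yN c by (simp add: comm_def)
  then have "y \<in> Z" using comm_in_Z[of c y] c yN by (simp add: Z_closed)
  then show False using D_Z[OF c] y by blast
qed

lemma ex_wreath_subgroups:
  "(\<nexists>p k. Factorial_Ring.prime (p::nat) \<and> card A = p ^ k) \<and>
   (\<exists>H K. subgroup H G \<and> subgroup K G \<and> H \<noteq> {\<one>} \<and> H \<subseteq> K \<and> K \<subset> A \<and>
     (\<forall>a\<in>A - K. \<forall>h\<in>H. \<exists>l\<in>L. \<exists>l'\<in>L. l \<otimes> a \<otimes> l' = a \<otimes> h))"
proof -
  obtain c where c: "c \<in> A" "c \<notin> Z" using ex_noncentral by blast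
  have "Z \<subset> A" using c Z_A by blast
  moreover have "H c \<subseteq> Z" unfolding H_def by blast
  moreover have "\<forall>a\<in>A - Z. \<forall>h\<in>H c. \<exists>l\<in>L. \<exists>l'\<in>L. l \<otimes> a \<otimes> l' = a \<otimes> h"
    using H_double_coset[OF c] by blast
  ultimately show ?thesis
    using card_not_prime_power subgroup_H[of c] subgroup_Z H_nontrivial[OF c] A_mem[OF c(1)]
    by blast
qed

end

section \<open>Permutation groups and invariant digraphs\<close>

lemma BijGroup_apply:
  assumes "f \<in> Bij Om" "g \<in> Bij Om" "x \<in> Om"
  shows "(f \<otimes>\<^bsub>BijGroup Om\<^esub> g) x = f (g x)"
  using assms by (simp add: BijGroup_def compose_eq)

lemma BijGroup_one_apply: "x \<in> Om \<Longrightarrow> \<one>\<^bsub>BijGroup Om\<^esub> x = x"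
  by (simp add: BijGroup_def)

lemma Bij_apply_mem: "f \<in> Bij Om \<Longrightarrow> x \<in> Om \<Longrightarrow> f x \<in> Om"
  using Bij_imp_funcset by blast

lemma BijGroup_inv_apply:
  assumes "f \<in> Bij Om" "x \<in> Om"
  shows "(inv\<^bsub>BijGroup Om\<^esub> f) (f x) = x" "f ((inv\<^bsub>BijGroup Om\<^esub> f) x) = x"
  using assms by (auto simp: inv_BijGroup Bij_apply_mem Bij_def bij_betw_def f_inv_into_f)

lemma (in group) mem_normalizer:
  assumes A: "subgroup A G" and x: "x \<in> carrier G" and fin: "finite A"
    and norm: "\<And>a. a \<in> A \<Longrightarrow> x \<otimes> a \<otimes> inv x \<in> A"
  shows "x \<in> normalizer G A"
proof -
  have sub: "A \<subseteq> carrier G" using A by (rule subgroup.subset)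
  have "x <# A #> inv x = (\<lambda>a. x \<otimes> a \<otimes> inv x) ` A"
    by (auto simp: l_coset_def r_coset_def)
  moreover have "inj_on (\<lambda>a. x \<otimes> a \<otimes> inv x) A"
    using x sub conjugation_is_inj[OF x] by (meson inj_onI subsetD)
  ultimately have "x <# A #> inv x = A"
    using norm fin by (simp add: endo_inj_surj image_subset_iff)
  then show ?thesis using x sub by (simp add: normalizer_def stabilizer_def)
qed

text \<open>Supplies a group between \<open>A\<close> and \<open>G\<close> in which \<open>A\<close>
  is maximal. Passing to it is harmless: \<open>A\<close> stays self-normalizing, and automorphisms
  of the digraph remain automorphisms.\<close>

lemma ex_minimal_overgroup:
  assumes fin: "finite (carrier G)" and G: "subgroup H G" "A \<subset> H"
  obtains B where "subgroup B G" "A \<subset> B" "B \<subseteq> H"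
    "\<And>C. subgroup C G \<Longrightarrow> A \<subseteq> C \<Longrightarrow> C \<subseteq> B \<Longrightarrow> C = A \<or> C = B"
proof -
  let ?S = "{B. subgroup B G \<and> A \<subset> B \<and> B \<subseteq> H}"
  have "?S \<subseteq> Pow (carrier G)" using subgroup.subset by blast
  then have "finite ?S" using fin by (meson finite_Pow_iff finite_subset)
  moreover have "H \<in> ?S" using G by blast
  ultimately have "\<exists>B\<in>?S. \<forall>C\<in>?S. C \<subseteq> B \<longrightarrow> B = C"
    by (intro finite_has_minimal) auto
  then obtain B where B: "B \<in> ?S" and min: "\<forall>C\<in>?S. C \<subseteq> B \<longrightarrow> B = C" by (rule bexE)
  show ?thesis
  proof (rule that[of B])
    fix C assume C: "subgroup C G" "A \<subseteq> C" "C \<subseteq> B"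
    show "C = A \<or> C = B"
    proof (cases "C = A")
      case False
      then have "C \<in> ?S" using C B by auto
      then show ?thesis using min C(3) by metis
    qed simp
  qed (use B in auto)
qed

theorem theorem4p2:
  fixes Om :: "'a set" and G A :: "('a \<Rightarrow> 'a) set"
  assumes "finite Om"
    and "subgroup G (BijGroup Om)"
    and "subgroup A (sub_grp Om G)"
    and "comm_group (sub_grp Om A)"
    and "regular_on Om A"
    and "A \<noteq> G"
    and "normalizer (sub_grp Om G) A = A"
  shows "\<not> (\<exists>p k. Factorial_Ring.prime (p::nat) \<and> card A = p ^ k) \<and>
    (\<exists>H K. subgroup H (sub_grp Om A) \<and> subgroup K (sub_grp Om A) \<and>
       H \<noteq> {\<one>\<^bsub>BijGroup Om\<^esub>} \<and> H \<subseteq> K \<and> K \<noteq> A \<and>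
       (\<forall>\<omega>\<in>Om. \<forall>R. digraph_on Om R \<and> (\<forall>g\<in>G. digraph_aut Om R g) \<longrightarrow>
          (\<exists>S. cayley_rep Om A \<omega> R S \<and> gen_wreath Om A H K S)))"
proof -
  let ?P = "BijGroup Om"
  interpret P: group ?P by (rule group_BijGroup)
  have carP: "carrier ?P = Bij Om" by (simp add: BijGroup_def)
  have "Bij Om \<subseteq> Om \<rightarrow>\<^sub>E Om"
    using Bij_imp_funcset Bij_imp_extensional by (auto simp: PiE_def)
  then have finP: "finite (carrier ?P)"
    unfolding carP using assms(1) finite_PiE[of Om "\<lambda>_. Om"] finite_subset by metis
  have G: "subgroup G ?P" by fact
  have AG: "A \<subset> G" using subgroup.subset[OF assms(3)] assms(6) by (auto simp: sub_grp_def)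
  have A: "subgroup A ?P" using P.incl_subgroup[OF G] assms(3) by (simp add: sub_grp_def)
  have GB: "g \<in> Bij Om" if "g \<in> G" for g using that subgroup.subset[OF G] carP by blast
  have AB: "g \<in> Bij Om" if "g \<in> A" for g using that GB AG by blast
  \<comment> \<open>A base point is needed for the stabilizer. On the empty set only the identity is
    a permutation, so \<open>A\<close> and \<open>G\<close> could not differ.\<close>
  have "Om \<noteq> {}"
  proof
    assume "Om = {}"
    then have "Bij Om \<subseteq> {\<one>\<^bsub>?P\<^esub>}" by (auto simp: Bij_def BijGroup_def extensional_def)
    then show False using AG GB subgroup.one_closed[OF A] by blast
  qed
  then obtain w where w: "w \<in> Om" by blast
  obtain B where B: "subgroup B ?P" "A \<subset> B" "B \<subseteq> G"
    and min: "\<And>C. subgroup C ?P \<Longrightarrow> A \<subseteq> C \<Longrightarrow> C \<subseteq> B \<Longrightarrow> C = A \<or> C = B"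
    using ex_minimal_overgroup[OF finP G AG] by metis
  interpret B: subgroup B ?P by (rule B(1))
  interpret A: subgroup A ?P by (rule A)
  have BB: "g \<in> Bij Om" if "g \<in> B" for g using that GB B by blast
  let ?B = "?P\<lparr>carrier := B\<rparr>"
  interpret GB: group ?B by (rule B.subgroup_is_group[OF P.is_group])
  define L where "L = {g \<in> B. g w = w}"
  have A_comm: "a \<otimes>\<^bsub>?P\<^esub> b = b \<otimes>\<^bsub>?P\<^esub> a" if "a \<in> A" "b \<in> A" for a b
    using comm_groupE(4)[OF assms(4)] that by (simp add: sub_grp_def)
  have trans: "\<exists>a\<in>A. a x = y" if "x \<in> Om" "y \<in> Om" for x y
    using assms(5) that unfolding regular_on_def by blast
  have semireg: "a = b" if "a \<in> A" "b \<in> A" "x \<in> Om" "a x = b x" for a b x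
    using assms(5) that Bij_apply_mem[OF AB] unfolding regular_on_def by metis
  have L: "subgroup L ?P"
  proof (rule P.subgroupI)
    show "L \<subseteq> carrier ?P" using B.subset by (auto simp: L_def)
    show "L \<noteq> {}" using w by (auto simp: L_def BijGroup_one_apply intro!: exI[of _ "\<one>\<^bsub>?P\<^esub>"])
  next
    fix g assume "g \<in> L"
    then show "inv\<^bsub>?P\<^esub> g \<in> L"
      using BijGroup_inv_apply(1)[OF BB w, of g] by (simp add: L_def)
  next
    fix g h assume "g \<in> L" "h \<in> L"
    then show "g \<otimes>\<^bsub>?P\<^esub> h \<in> L"
      using w by (simp add: L_def BijGroup_apply BB)
  qed
  have LB: "subgroup L ?B" using P.subgroup_incl[OF L B(1)] by (auto simp: L_def)
  interpret M: maximal_selfnormalizing ?B A L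
  proof (intro maximal_selfnormalizing.intro maximal_selfnormalizing_axioms.intro GB.is_group)
    show "finite (carrier ?B)" using finP B.subset finite_subset by auto
    show "subgroup A ?B" using P.subgroup_incl[OF A B(1)] B(2) by blast
    show "subgroup L ?B" by (rule LB)
    show "A \<noteq> carrier ?B" using B by simp
    show "a \<otimes>\<^bsub>?B\<^esub> b = b \<otimes>\<^bsub>?B\<^esub> a" if "a \<in> A" "b \<in> A" for a b using A_comm that by simp
    show "x = \<one>\<^bsub>?B\<^esub>" if "x \<in> A" "x \<in> L" for x
      using semireg[of x "\<one>\<^bsub>?P\<^esub>" w] that w by (simp add: L_def BijGroup_one_apply)
    show "C = A \<or> C = carrier ?B" if "subgroup C ?B" "A \<subseteq> C" for C
      using min[of C] P.incl_subgroup[OF B(1) that(1)] subgroup.subset[OF that(1)] that(2) by simp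
  next
    fix x assume "x \<in> carrier ?B"
    then have x: "x \<in> B" by simp
    \<comment> \<open>\<open>b\<close> agrees with the inverse of \<open>x\<close> at
      \<open>w\<close>, so \<open>x\<close> times \<open>b\<close> fixes \<open>w\<close>.\<close>
    obtain b where b: "b \<in> A" "b w = (inv\<^bsub>?P\<^esub> x) w"
      using trans[of w "(inv\<^bsub>?P\<^esub> x) w"] w Bij_apply_mem[OF BB[OF B.m_inv_closed[OF x]] w] by blast
    have bB: "b \<in> B" using b B by blast
    have "x \<otimes>\<^bsub>?P\<^esub> b \<in> L"
      using x bB b w BijGroup_inv_apply(2)[OF BB[OF x] w] by (simp add: L_def BijGroup_apply BB)
    moreover have "x = (x \<otimes>\<^bsub>?P\<^esub> b) \<otimes>\<^bsub>?P\<^esub> inv\<^bsub>?P\<^esub> b"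
      using x bB by (simp add: P.m_assoc)
    ultimately show "\<exists>l\<in>L. \<exists>a\<in>A. x = l \<otimes>\<^bsub>?B\<^esub> a" using b by force
  next
    fix x assume "x \<in> carrier ?B" and core: "\<And>a. a \<in> A \<Longrightarrow> inv\<^bsub>?B\<^esub> a \<otimes>\<^bsub>?B\<^esub> x \<otimes>\<^bsub>?B\<^esub> a \<in> L"
    then have x: "x \<in> B" by simp
    \<comment> \<open>The conjugate of \<open>x\<close> fixes \<open>w\<close> exactly when
      \<open>x\<close> fixes \<open>a w\<close>, and every point has the form
      \<open>a w\<close>.\<close>
    have "x y = y" if y: "y \<in> Om" for y
    proof -
      obtain a where a: "a \<in> A" "a w = y" using trans w y by blast
      have aB: "a \<in> B" using a B by blast
      let ?i = "inv\<^bsub>?P\<^esub> a"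
      have "?i \<otimes>\<^bsub>?P\<^esub> x \<otimes>\<^bsub>?P\<^esub> a \<in> L" using core[OF a(1)] aB B(1) by simp
      then have "?i (x y) = w"
        using x aB a w y Bij_apply_mem[OF BB[OF aB]] by (simp add: L_def BijGroup_apply BB)
      then have "a (?i (x y)) = y" using a by simp
      then show ?thesis using BijGroup_inv_apply(2)[OF BB[OF aB]] Bij_apply_mem[OF BB[OF x] y] by simp
    qed
    then have "x = \<one>\<^bsub>?P\<^esub>"
      using Bij_imp_extensional[OF BB[OF x]] by (auto simp: BijGroup_def extensional_def)
    then show "x = \<one>\<^bsub>?B\<^esub>" by simp
  next
    fix x assume "x \<in> carrier ?B" and norm: "\<And>a. a \<in> A \<Longrightarrow> x \<otimes>\<^bsub>?B\<^esub> a \<otimes>\<^bsub>?B\<^esub> inv\<^bsub>?B\<^esub> x \<in> A"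
    then have x: "x \<in> B" by simp
    interpret GG: group "sub_grp Om G"
      unfolding sub_grp_def using G P.is_group by (rule subgroup.subgroup_is_group)
    have "x \<in> normalizer (sub_grp Om G) A"
    proof (rule GG.mem_normalizer[OF assms(3)])
      show "x \<in> carrier (sub_grp Om G)" using x B by (auto simp: sub_grp_def)
      show "finite A" using finP A.subset finite_subset by blast
      show "x \<otimes>\<^bsub>sub_grp Om G\<^esub> a \<otimes>\<^bsub>sub_grp Om G\<^esub> inv\<^bsub>sub_grp Om G\<^esub> x \<in> A" if "a \<in> A" for a
        using norm[OF that] x B(1,3) G by (simp add: sub_grp_def subset_iff)
    qed
    then show "x \<in> A" using assms(7) by simp
  qed
  have B_ops: "monoid.mult ?B = monoid.mult ?P" "\<one>\<^bsub>?B\<^esub> = \<one>\<^bsub>?P\<^esub>" by simp_all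
  obtain H K where np: "\<nexists>p k. Factorial_Ring.prime (p::nat) \<and> card A = p ^ k"
    and H: "subgroup H ?B" and K: "subgroup K ?B" and H1: "H \<noteq> {\<one>\<^bsub>?P\<^esub>}" and HK: "H \<subseteq> K" "K \<subset> A"
    and double: "\<And>a h. a \<in> A \<Longrightarrow> a \<notin> K \<Longrightarrow> h \<in> H \<Longrightarrow>
      \<exists>l\<in>L. \<exists>l'\<in>L. l \<otimes>\<^bsub>?P\<^esub> a \<otimes>\<^bsub>?P\<^esub> l' = a \<otimes>\<^bsub>?P\<^esub> h"
    using M.ex_wreath_subgroups unfolding B_ops by (elim conjE exE) blast
  have HP: "subgroup H ?P" and KP: "subgroup K ?P" using H K P.incl_subgroup[OF B(1)] by auto
  have HA: "subgroup H (sub_grp Om A)" and KA: "subgroup K (sub_grp Om A)"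
    using P.subgroup_incl[OF HP A] P.subgroup_incl[OF KP A] HK by (auto simp: sub_grp_def)
  have "\<exists>S. cayley_rep Om A v R S \<and> gen_wreath Om A H K S"
    if v: "v \<in> Om" and aut: "\<forall>g\<in>G. digraph_aut Om R g" for v R
  proof -
    \<comment> \<open>The base point here is \<open>w\<close>, while the identification uses
      \<open>v\<close>: as \<open>A\<close> is abelian, the connection set is the same for all base
      points.\<close>
    define S where "S = {a \<in> A. (a w, w) \<in> R}"
    have inv_R: "(g x, g y) \<in> R \<longleftrightarrow> (x, y) \<in> R" if "g \<in> G" "x \<in> Om" "y \<in> Om" for g x y
      using aut that by (simp add: digraph_aut_def)
    obtain b where b: "b \<in> A" "b w = v" using trans w v by blast
    have "(g v, h v) \<in> R \<longleftrightarrow> g \<otimes>\<^bsub>?P\<^esub> inv\<^bsub>?P\<^esub> h \<in> S" if gh: "g \<in> A" "h \<in> A" for g h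
    proof -
      \<comment> \<open>\<open>?e\<close> maps \<open>w\<close> to \<open>h v\<close> and, by
        commutativity, \<open>?d w\<close> to \<open>g v\<close>; it is an automorphism of the
        digraph.\<close>
      let ?d = "g \<otimes>\<^bsub>?P\<^esub> inv\<^bsub>?P\<^esub> h" and ?e = "h \<otimes>\<^bsub>?P\<^esub> b"
      have e: "?e \<in> A" "?d \<in> A" using gh b by simp_all
      have "g \<otimes>\<^bsub>?P\<^esub> b = ?d \<otimes>\<^bsub>?P\<^esub> ?e"
        using gh b by (simp add: P.m_assoc P.inv_mult_cancel)
      also have "\<dots> = ?e \<otimes>\<^bsub>?P\<^esub> ?d" using A_comm e by simp
      finally have "g v = ?e (?d w)" using gh b w AB e by (metis BijGroup_apply)
      moreover have "h v = ?e w" using gh b w AB by (metis BijGroup_apply)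
      ultimately show ?thesis
        using inv_R[of ?e "?d w" w] e w AG Bij_apply_mem[OF AB[OF e(2)] w] by (auto simp: S_def)
    qed
    then have "cayley_rep Om A v R S"
      using A by (simp add: cayley_rep_def S_def sub_grp_def)
    moreover have "gen_wreath Om A H K S"
    proof -
      have coset: "H #>\<^bsub>?P\<^esub> a \<subseteq> S - K" if a: "a \<in> S - K" for a
      proof
        fix x assume "x \<in> H #>\<^bsub>?P\<^esub> a"
        then obtain h where h: "h \<in> H" "x = h \<otimes>\<^bsub>?P\<^esub> a" by (auto simp: r_coset_def)
        have aA: "a \<in> A" "(a w, w) \<in> R" "a \<notin> K" using a by (auto simp: S_def)
        have hA: "h \<in> A" "h \<in> K" using h HK by auto
        have xah: "x = a \<otimes>\<^bsub>?P\<^esub> h" using h hA aA A_comm by simp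
        obtain l l' where l: "l \<in> L" "l' \<in> L" "l \<otimes>\<^bsub>?P\<^esub> a \<otimes>\<^bsub>?P\<^esub> l' = x"
          using double[OF aA(1,3) h(1)] xah by blast
        have lB: "l \<in> B" "l' \<in> B" "l w = w" "l' w = w" using l by (auto simp: L_def)
        \<comment> \<open>\<open>l'\<close> fixes \<open>w\<close>, and \<open>l\<close> is an
          automorphism fixing \<open>w\<close>; it carries the arc \<open>(a w, w)\<close> to
          \<open>(x w, w)\<close>.\<close>
        have "x w = l (a w)"
          using l(3) lB BB AB aA w B.m_closed B(2) by (metis BijGroup_apply psubsetD)
        then have "(x w, w) \<in> R"
          using inv_R[of l "a w" w] aA lB B(3) w Bij_apply_mem[OF AB w] by (auto simp: subset_iff)
        moreover have "x \<in> A" using h hA aA by simp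
        moreover have "x \<notin> K"
        proof
          assume "x \<in> K"
          then have "inv\<^bsub>?P\<^esub> h \<otimes>\<^bsub>?P\<^esub> x \<in> K" using hA KP by (simp add: subgroup.m_closed subgroup.m_inv_closed)
          then show False using h hA aA by (simp add: P.inv_mult_cancel)
        qed
        ultimately show "x \<in> S - K" by (simp add: S_def)
      qed
      have self: "a \<in> H #>\<^bsub>?P\<^esub> a" if "a \<in> A" for a
        using that P.rcos_self[OF _ HP] by simp
      have "S - K = \<Union> ((\<lambda>a. H #>\<^bsub>?P\<^esub> a) ` (S - K))"
        using coset self by (auto simp: S_def)
      moreover have "(\<lambda>a. H #>\<^bsub>?P\<^esub> a) ` (S - K) \<subseteq> rcosets\<^bsub>sub_grp Om A\<^esub> H"
        by (auto simp: RCOSETS_def sub_grp_def S_def)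
      ultimately show ?thesis unfolding gen_wreath_def by blast
    qed
    ultimately show ?thesis by blast
  qed
  then show ?thesis using np HA KA H1 HK by blast
qed

end
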